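(* Let $C$ be a cycle of length 3 in the complete graph $K_4$. Then $\tau(\mathrm{Blowup}(K_4,C))=5$.
   Context: The perfect matching index $\tau(H)$ of a cubic graph $H$ is the minimum number of perfect matchings of $H$ needed to cover $E(H)$. A multipole consists of vertices, edges, and semiedges; a semiedge is an edge incident to exactly one vertex, with its other end free. Connecting a semiedge to a vertex $v$ means attaching its free end to $v$, making it an ordinary edge. The 4-pole $B$: take the Petersen graph and remove two adjacent vertices $x,y$, keeping the four edges from $\{x,y\}$ to the remaining 8 vertices as semiedges. The two semiedges coming from edges formerly incident to $x$ are called $a_1,a_2$, and the two coming from edges formerly incident to $y$ are called $b_1,b_2$. $\mathrm{Blowup}(G,D)$, for a 2-edge-connected cubic graph $G$ and a 2-regular subgraph $D$ of $G$: for every cycle $(v_1,\dots,v_k)$ of $D$ (indices modulo $k$), remove all edges $v_iv_{i+1}$ and add $k$ copies $B_1,\dots,B_k$ of $B$, with semiedges $a_1^i,a_2^i,b_1^i,b_2^i$ of $B_i$. For each $i\in\{1,\dots,k\}$ add two new vertices $u_i,w_i$ and the edges $v_iu_i$, $v_iw_i$, and connect $u_i$ with $b_1^i$, $w_i$ with $b_2^i$, $a_1^i$ with $u_{i+1}$, and $a_2^i$ with $w_{i+1}$. (So $\mathrm{Blowup}(K_4,C)$ has 34 vertices.) *)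

theory Defs
  imports "HOL-Library.Extended_Nat"
begin

section \<open>Simple graphs and perfect matchings\<close>

record 'a ugraph =
  verts :: "'a set"
  edges :: "'a set set"

definition complete_graph :: "'a set \<Rightarrow> 'a ugraph" where
  "complete_graph V = \<lparr>verts = V, edges = {e. e \<subseteq> V \<and> card e = 2}\<rparr>"

definition perfect_matching :: "'a ugraph \<Rightarrow> 'a set set \<Rightarrow> bool" where
  "perfect_matching G M \<longleftrightarrow> M \<subseteq> edges G \<and> (\<forall>v\<in>verts G. \<exists>!e. e \<in> M \<and> v \<in> e)"

text \<open>The value is \<open>\<infinity>\<close> if no finite family of perfect matchings covers the edges.\<close>

definition perfect_matching_index :: "'a ugraph \<Rightarrow> enat" where
  "perfect_matching_index G =
     Inf {enat (card \<M>) | \<M>. finite \<M> \<and> (\<forall>M\<in>\<M>. perfect_matching G M) \<and> \<Union>\<M> = edges G}"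

text \<open>A cycle is given by the list of its vertices in cyclic order, as the blowup construction
  refers to such an order.\<close>

definition next_index :: "'a list \<Rightarrow> nat \<Rightarrow> nat" where
  "next_index c i = Suc i mod length c"

definition cycle_edges :: "'a list \<Rightarrow> 'a set set" where
  "cycle_edges c = {{c ! i, c ! next_index c i} | i. i < length c}"

definition is_cycle :: "'a ugraph \<Rightarrow> 'a list \<Rightarrow> bool" where
  "is_cycle G c \<longleftrightarrow>
     3 \<le> length c \<and> distinct c \<and> set c \<subseteq> verts G \<and> cycle_edges c \<subseteq> edges G"


section \<open>The 4-pole obtained from the Petersen graph\<close>

text \<open>The Petersen graph is the Kneser graph of the 2-subsets of a 5-set.\<close>

definition petersen :: "nat set ugraph" where
  "petersen =
     \<lparr>verts = {s. s \<subseteq> {0..<5} \<and> card s = 2},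
      edges = {{s, t} | s t. s \<subseteq> {0..<5} \<and> card s = 2 \<and> t \<subseteq> {0..<5} \<and> card t = 2 \<and> s \<inter> t = {}}\<rparr>"

text \<open>A multipole is a graph together with semiedges, indexed here by a type \<open>'s\<close>;
  \<open>semi_end\<close> maps each semiedge to the vertex it is incident to.\<close>

record ('a, 's) multipole = "'a ugraph" +
  semi_end :: "'s \<Rightarrow> 'a"

datatype semiedge = A1 | A2 | B1 | B2

definition pole_x :: "nat set" where "pole_x = {0, 1}"
definition pole_y :: "nat set" where "pole_y = {2, 3}"

text \<open>The automorphisms of the Petersen graph fixing \<open>x\<close> and \<open>y\<close> swap the two other neighbours
  of \<open>x\<close> and the two other neighbours of \<open>y\<close> independently, so the choice of
  the names within the pairs \<open>A1, A2\<close> and \<open>B1, B2\<close> is immaterial.\<close>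

definition pole_B :: "(nat set, semiedge) multipole" where
  "pole_B =
     \<lparr>verts = verts petersen - {pole_x, pole_y},
      edges = {e \<in> edges petersen. pole_x \<notin> e \<and> pole_y \<notin> e},
      semi_end = (\<lambda>s. case s of A1 \<Rightarrow> {2, 4} | A2 \<Rightarrow> {3, 4} | B1 \<Rightarrow> {0, 4} | B2 \<Rightarrow> {1, 4})\<rparr>"

lemma petersen_adj_iff:
  "{s, t} \<in> edges petersen \<longleftrightarrow>
     s \<subseteq> {0..<5} \<and> card s = 2 \<and> t \<subseteq> {0..<5} \<and> card t = 2 \<and> s \<inter> t = {}"
  unfolding petersen_def by (simp add: doubleton_eq_iff) blast

lemma pole_x_neighbours:
  "{pole_x, pole_y} \<in> edges petersen"
  "{pole_x, semi_end pole_B A1} \<in> edges petersen"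
  "{pole_x, semi_end pole_B A2} \<in> edges petersen"
  unfolding petersen_adj_iff by (simp_all add: pole_x_def pole_y_def pole_B_def)

lemma pole_y_neighbours:
  "{pole_y, pole_x} \<in> edges petersen"
  "{pole_y, semi_end pole_B B1} \<in> edges petersen"
  "{pole_y, semi_end pole_B B2} \<in> edges petersen"
  unfolding petersen_adj_iff by (simp_all add: pole_x_def pole_y_def pole_B_def)


section \<open>The blowup construction\<close>

text \<open>Since the cycles of a 2-regular subgraph are disjoint, \<open>u\<^sub>i\<close>, \<open>w\<^sub>i\<close> and the copy \<open>B\<^sub>i\<close> are
  indexed by the vertex \<open>v\<^sub>i\<close> of \<open>G\<close>.\<close>

datatype 'a blowup_vertex =
    Orig 'a
  | U 'a
  | W 'a
  | Pole 'a "nat set"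

text \<open>The edges added for \<open>v = v\<^sub>i\<close>, where \<open>v' = v\<^bsub>i+1\<^esub>\<close>.\<close>

definition blowup_gadget :: "'a \<Rightarrow> 'a \<Rightarrow> 'a blowup_vertex set set" where
  "blowup_gadget v v' =
     (\<lambda>e. Pole v ` e) ` edges pole_B \<union>
     {{Orig v, U v}, {Orig v, W v},
      {U v, Pole v (semi_end pole_B B1)}, {W v, Pole v (semi_end pole_B B2)},
      {Pole v (semi_end pole_B A1), U v'}, {Pole v (semi_end pole_B A2), W v'}}"

text \<open>The 2-regular subgraph is given by the set \<open>D\<close> of its cycles, one list per cycle; these
  are meant to be pairwise disjoint cycles of \<open>G\<close>. Reversing a list gives an isomorphic blowup,
  because an automorphism of the Petersen graph exchanges \<open>x\<close> and \<open>y\<close>.\<close>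

definition blowup :: "'a ugraph \<Rightarrow> 'a list set \<Rightarrow> 'a blowup_vertex ugraph" where
  "blowup G D =
     \<lparr>verts = Orig ` verts G \<union>
        (\<Union>c\<in>D. \<Union>v\<in>set c. {U v, W v} \<union> Pole v ` verts pole_B),
      edges = (\<lambda>e. Orig ` e) ` (edges G - (\<Union>c\<in>D. cycle_edges c)) \<union>
        (\<Union>c\<in>D. \<Union>i<length c. blowup_gadget (c ! i) (c ! next_index c i))\<rparr>"

end

theory Submission
  imports Defs
begin

text \<open>Label every edge by the set of those of four perfect matchings that contain it. If the matchings
  cover the graph, the three labels at each vertex partition the set of the four matchings into
  nonempty parts, so that one of them has two elements and the others have one. The label sums of
  the two ends of the 4-pole agree modulo 2, and the two labels cannot be disjoint at both ends with
  a union other than the whole set, since filling in \<open>x\<close> and \<open>y\<close> would give a cover of the Petersen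
  graph by four perfect matchings. Consequently, an end of sizes (1,2) is opposite to an end of sizes
  (1,2), where the labels intersect, and an end of two distinct singletons is opposite to an end of
  sizes (2,2). Where the edge leaving the triangle has a singleton label, the ends of the two 4-poles
  meeting there are one of each of these two kinds. Two of the three edges at the fourth vertex have
  singleton labels, and following the ring through the two corresponding vertices yields ends of
  sizes (2,2) on both sides of the third one, where the label has size 2; but there the four sizes
  add up to 6.\<close>

section \<open>Four perfect matchings of the Petersen graph\<close>

definition exactly_one :: "bool \<Rightarrow> bool \<Rightarrow> bool \<Rightarrow> bool" where
  "exactly_one p q r \<longleftrightarrow> p \<and> \<not> q \<and> \<not> r \<or> \<not> p \<and> q \<and> \<not> r \<or> \<not> p \<and> \<not> q \<and> r"

definition tripartition :: "nat set \<Rightarrow> nat set \<Rightarrow> nat set \<Rightarrow> bool" where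
  "tripartition X Y Z \<longleftrightarrow> X \<noteq> {} \<and> Y \<noteq> {} \<and> Z \<noteq> {} \<and>
     X \<inter> Y = {} \<and> X \<inter> Z = {} \<and> Y \<inter> Z = {} \<and> X \<union> Y \<union> Z = {..<4}"

lemma tripartition_exactly_one:
  "tripartition X Y Z \<Longrightarrow> k < 4 \<Longrightarrow> exactly_one (k \<in> X) (k \<in> Y) (k \<in> Z)"
  unfolding tripartition_def exactly_one_def by blast

text \<open>The Petersen graph has six perfect matchings, and every two of them share exactly one edge;
  \<open>eij\<close> stands for the edge common to the \<open>i\<close>-th and the \<open>j\<close>-th matching.\<close>

definition petersen_matching_type :: "nat \<Rightarrow> bool \<Rightarrow> bool \<Rightarrow> bool \<Rightarrow> bool \<Rightarrow> bool \<Rightarrow> bool \<Rightarrow> bool \<Rightarrow>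
    bool \<Rightarrow> bool \<Rightarrow> bool \<Rightarrow> bool \<Rightarrow> bool \<Rightarrow> bool \<Rightarrow> bool \<Rightarrow> bool \<Rightarrow> bool" where
  "petersen_matching_type t e01 e02 e03 e04 e05 e12 e13 e14 e15 e23 e24 e25 e34 e35 e45 \<longleftrightarrow>
     (e01 \<longleftrightarrow> t \<in> {0, 1}) \<and> (e02 \<longleftrightarrow> t \<in> {0, 2}) \<and> (e03 \<longleftrightarrow> t \<in> {0, 3}) \<and>
     (e04 \<longleftrightarrow> t \<in> {0, 4}) \<and> (e05 \<longleftrightarrow> t \<in> {0, 5}) \<and> (e12 \<longleftrightarrow> t \<in> {1, 2}) \<and>
     (e13 \<longleftrightarrow> t \<in> {1, 3}) \<and> (e14 \<longleftrightarrow> t \<in> {1, 4}) \<and> (e15 \<longleftrightarrow> t \<in> {1, 5}) \<and>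
     (e23 \<longleftrightarrow> t \<in> {2, 3}) \<and> (e24 \<longleftrightarrow> t \<in> {2, 4}) \<and> (e25 \<longleftrightarrow> t \<in> {2, 5}) \<and>
     (e34 \<longleftrightarrow> t \<in> {3, 4}) \<and> (e35 \<longleftrightarrow> t \<in> {3, 5}) \<and> (e45 \<longleftrightarrow> t \<in> {4, 5})"

text \<open>The ten assumptions are the ten vertices. The six perfect matchings split into three
  pairs at each vertex, so every triple uses all six indices. A choice of edges meeting each vertex
  once is a perfect matching, hence one of the six.\<close>

lemma ex_petersen_matching_type:
  assumes "exactly_one e01 e23 e45" "exactly_one e24 e05 e13" "exactly_one e35 e12 e04"
    "exactly_one e14 e03 e25" "exactly_one e35 e14 e02" "exactly_one e24 e03 e15"
    "exactly_one e05 e12 e34" "exactly_one e01 e25 e34" "exactly_one e23 e04 e15"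
    "exactly_one e45 e13 e02"
  shows "\<exists>t<6. petersen_matching_type t e01 e02 e03 e04 e05 e12 e13 e14 e15 e23 e24 e25 e34 e35 e45"
proof -
  have split: "(\<exists>t<6. P t) \<longleftrightarrow> P 0 \<or> P 1 \<or> P 2 \<or> P 3 \<or> P 4 \<or> P 5" for P :: "nat \<Rightarrow> bool"
    by (simp add: numeral_eq_Suc less_Suc_eq ex_disj_distrib conj_disj_distribL) blast
  show ?thesis
    using assms unfolding split exactly_one_def petersen_matching_type_def by (simp; smt (verit))
qed

text \<open>Four matchings realise at most four of the six types. If \<open>i\<close> and
  \<open>j\<close> are two missing types, no matching contains the edge \<open>eij\<close>, whose
  label would be empty.\<close>

lemma no_petersen_tripartitions:
  assumes "tripartition e01 e23 e45" "tripartition e24 e05 e13" "tripartition e35 e12 e04"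
    "tripartition e14 e03 e25" "tripartition e35 e14 e02" "tripartition e24 e03 e15"
    "tripartition e05 e12 e34" "tripartition e01 e25 e34" "tripartition e23 e04 e15"
    "tripartition e45 e13 e02"
  shows False
proof -
  have "\<forall>k<4. \<exists>t<6. petersen_matching_type t (k \<in> e01) (k \<in> e02) (k \<in> e03) (k \<in> e04) (k \<in> e05)
      (k \<in> e12) (k \<in> e13) (k \<in> e14) (k \<in> e15) (k \<in> e23)
      (k \<in> e24) (k \<in> e25) (k \<in> e34) (k \<in> e35) (k \<in> e45)"
    by (intro allI impI ex_petersen_matching_type assms[THEN tripartition_exactly_one])
  then obtain t where t: "\<forall>k<4. t k < 6 \<and> petersen_matching_type (t k) (k \<in> e01) (k \<in> e02) (k \<in> e03) (k \<in> e04) (k \<in> e05)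
      (k \<in> e12) (k \<in> e13) (k \<in> e14) (k \<in> e15) (k \<in> e23)
      (k \<in> e24) (k \<in> e25) (k \<in> e34) (k \<in> e35) (k \<in> e45)"
    by metis
  \<comment> \<open>In terms of types, this says that the edge \<open>eij\<close> is
    covered.\<close>
  define hit where "hit i j \<longleftrightarrow> (\<exists>k<4. t k = i \<or> t k = j)" for i j
  have nonempty: "\<exists>k<4. k \<in> X" "\<exists>k<4. k \<in> Y" "\<exists>k<4. k \<in> Z" if "tripartition X Y Z" for X Y Z
    using that unfolding tripartition_def by blast+
  note ne = assms[THEN nonempty(1)] assms[THEN nonempty(2)] assms[THEN nonempty(3)]
  have "hit 0 1 \<and> hit 0 2 \<and> hit 0 3 \<and> hit 0 4 \<and> hit 0 5 \<and> hit 1 2 \<and> hit 1 3 \<and> hit 1 4 \<and> hit 1 5 \<and> hit 2 3 \<and> hit 2 4 \<and> hit 2 5 \<and> hit 3 4 \<and> hit 3 5 \<and> hit 4 5"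
    using ne t unfolding petersen_matching_type_def hit_def by simp blast
  then have hit: "hit i j" if "i < j" "j < 6" for i j
    using that by (auto simp: numeral_eq_Suc less_Suc_eq)
  let ?T = "{..<6} - t ` {..<4}"
  have "card (t ` {..<4}) \<le> 4"
    using card_image_le[of "{..<4}" t] by simp
  then have "2 \<le> card ?T"
    using diff_card_le_card_Diff[of "t ` {..<4}" "{..<6}"] by simp
  then obtain S where "S \<subseteq> ?T" "card S = 2"
    by (meson obtain_subset_with_card_n)
  then obtain i j where ij: "i \<in> ?T" "j \<in> ?T" "i \<noteq> j"
    by (auto simp: card_2_iff)
  then have "hit i j \<or> hit j i"
    using hit by (metis DiffD1 lessThan_iff nat_neq_iff)
  then show False
    using ij by (auto simp: hit_def)
qed

section \<open>Labellings of the 4-pole and of the ring\<close>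

lemma tripartition_commute:
  "tripartition X Y Z \<longleftrightarrow> tripartition Y X Z" "tripartition X Y Z \<longleftrightarrow> tripartition X Z Y"
  unfolding tripartition_def by blast+

lemma tripartition_subset: "tripartition X Y Z \<Longrightarrow> X \<subseteq> {..<4}"
  using Un_upper1[of X "Y \<union> Z"] by (simp add: tripartition_def Un_assoc)

lemma tripartition_nonempty: "tripartition X Y Z \<Longrightarrow> X \<noteq> {}"
  by (simp add: tripartition_def)

lemma tripartition_finite:
  assumes "tripartition X Y Z"
  shows "finite X" "finite Y" "finite Z"
proof -
  have "finite (X \<union> Y \<union> Z)"
    using assms by (simp add: tripartition_def)
  then show "finite X" "finite Y" "finite Z"
    by simp_all
qed

lemma tripartition_card:
  assumes "tripartition X Y Z"
  shows "card X + card Y + card Z = 4" "1 \<le> card X" "1 \<le> card Y" "1 \<le> card Z"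
proof -
  note fin = tripartition_finite[OF assms]
  have ne: "X \<noteq> {}" "Y \<noteq> {}" "Z \<noteq> {}" and disj: "X \<inter> Y = {}" "(X \<union> Y) \<inter> Z = {}"
    and un: "X \<union> Y \<union> Z = {..<4}"
    using assms by (simp_all add: tripartition_def Int_Un_distrib2)
  have "card (X \<union> Y \<union> Z) = card X + card Y + card Z"
    using fin disj by (simp only: card_Un_disjoint finite_Un simp_thms)
  then show "card X + card Y + card Z = 4"
    unfolding un by simp
  show "1 \<le> card X" "1 \<le> card Y" "1 \<le> card Z"
    using fin ne by (simp_all add: Suc_le_eq card_gt_0_iff)
qed

section \<open>Constraints between the two ends of the 4-pole\<close>

text \<open>Each of the eight vertices lies on exactly one chosen edge. An inner edge accounts for
  two vertices and a semiedge for one, so the number of chosen semiedges is even.\<close>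

lemma pole_parity:
  assumes "exactly_one a1 e04 e15" "exactly_one a2 e02 e13" "exactly_one b1 e03 e14" "exactly_one b2 e05 e12"
    "exactly_one e24 e05 e13" "exactly_one e35 e12 e04" "exactly_one e35 e14 e02" "exactly_one e24 e03 e15"
  shows "(a1 \<noteq> a2) = (b1 \<noteq> b2)"
  using assms unfolding exactly_one_def by (cases e24; cases e35; cases e02; cases e03; cases e04; cases e05; simp)

text \<open>The variables \<open>eij\<close> are the edges of the Petersen graph as before; those at \<open>x\<close> and \<open>y\<close> are
  \<open>e01\<close> (between them), \<open>e23 = a1\<close>, \<open>e45 = a2\<close>, \<open>e25 = b1\<close>, \<open>e34 = b2\<close>.\<close>

definition pole_boundary :: "nat set \<Rightarrow> nat set \<Rightarrow> nat set \<Rightarrow> nat set \<Rightarrow> bool" where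
  "pole_boundary a1 a2 b1 b2 \<longleftrightarrow> (\<exists>e02 e03 e04 e05 e12 e13 e14 e15 e24 e35.
     tripartition a1 e04 e15 \<and> tripartition a2 e02 e13 \<and>
     tripartition b1 e03 e14 \<and> tripartition b2 e05 e12 \<and>
     tripartition e24 e05 e13 \<and> tripartition e35 e12 e04 \<and>
     tripartition e35 e14 e02 \<and> tripartition e24 e03 e15)"

text \<open>This is \<open>pole_parity\<close> applied to each of the four matchings.\<close>

lemma pole_boundary_sym_diff:
  assumes "pole_boundary a1 a2 b1 b2"
  shows "a1 \<union> a2 - a1 \<inter> a2 = b1 \<union> b2 - b1 \<inter> b2"
proof -
  obtain e02 e03 e04 e05 e12 e13 e14 e15 e24 e35 where e:
    "tripartition a1 e04 e15" "tripartition a2 e02 e13"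
    "tripartition b1 e03 e14" "tripartition b2 e05 e12"
    "tripartition e24 e05 e13" "tripartition e35 e12 e04"
    "tripartition e35 e14 e02" "tripartition e24 e03 e15"
    using assms unfolding pole_boundary_def by blast
  have "((k \<in> a1) \<noteq> (k \<in> a2)) = ((k \<in> b1) \<noteq> (k \<in> b2))" if "k < 4" for k
    by (rule pole_parity[OF e[THEN tripartition_exactly_one, OF that]])
  moreover have "a1 \<union> a2 \<union> b1 \<union> b2 \<subseteq> {..<4}"
    using e(1-4) by (simp add: tripartition_subset)
  ultimately show ?thesis
    by blast
qed

lemma pole_boundary_not_disjoint:
  assumes pole: "pole_boundary a1 a2 b1 b2" and disj: "a1 \<inter> a2 = {}" "b1 \<inter> b2 = {}"
  shows "a1 \<union> a2 = {..<4}"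
proof (rule ccontr)
  assume ne: "a1 \<union> a2 \<noteq> {..<4}"
  obtain e02 e03 e04 e05 e12 e13 e14 e15 e24 e35 where e:
    "tripartition a1 e04 e15" "tripartition a2 e02 e13"
    "tripartition b1 e03 e14" "tripartition b2 e05 e12"
    "tripartition e24 e05 e13" "tripartition e35 e12 e04"
    "tripartition e35 e14 e02" "tripartition e24 e03 e15"
    using pole unfolding pole_boundary_def by blast
  have eq: "a1 \<union> a2 = b1 \<union> b2"
    using pole_boundary_sym_diff[OF pole] disj by simp
  \<comment> \<open>The label of the restored edge between \<open>x\<close> and \<open>y\<close>.
    The same set serves both ends because the two unions agree, and it is nonempty by
    \<open>ne\<close>.\<close>
  define xy where "xy = {..<4} - (a1 \<union> a2)"
  have xy: "tripartition xy a1 a2" "tripartition xy b1 b2"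
    using e(1-4)[THEN tripartition_nonempty] e(1-4)[THEN tripartition_subset] ne disj eq
    unfolding tripartition_def xy_def by auto
  show False
    by (rule no_petersen_tripartitions[of xy a1 a2 e24 e05 e13 e35 e12 e04 e14 e03 b1 e02 e15 b2])
      (use e xy tripartition_commute in blast)+
qed

text \<open>Here \<open>d\<close> is the size of the symmetric difference, which is common to both
  ends. This leaves only arithmetic for the following lemmas.\<close>

lemma pole_boundary_card:
  assumes "pole_boundary a1 a2 b1 b2"
  obtains d where
    "card a1 + card a2 = d + 2 * card (a1 \<inter> a2)" "card b1 + card b2 = d + 2 * card (b1 \<inter> b2)"
    "card (a1 \<inter> a2) = 0 \<Longrightarrow> card (b1 \<inter> b2) = 0 \<Longrightarrow> d = 4"
proof -
  have fin: "finite a1" "finite a2" "finite b1" "finite b2"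
    using assms tripartition_finite(1) unfolding pole_boundary_def by blast+
  have card: "card X + card Y = card (X \<union> Y - X \<inter> Y) + 2 * card (X \<inter> Y)"
    if "finite X" "finite Y" for X Y :: "nat set"
  proof -
    have "card (X \<union> Y - X \<inter> Y) + card (X \<inter> Y) = card (X \<union> Y)"
      using that by (subst card_Un_disjoint[symmetric]) (auto intro!: arg_cong[where f = card])
    then show ?thesis
      using card_Un_Int[OF that] by simp
  qed
  show thesis
  proof (rule that)
    show "card a1 + card a2 = card (a1 \<union> a2 - a1 \<inter> a2) + 2 * card (a1 \<inter> a2)"
      using fin by (intro card)
    show "card b1 + card b2 = card (a1 \<union> a2 - a1 \<inter> a2) + 2 * card (b1 \<inter> b2)"
      using fin unfolding pole_boundary_sym_diff[OF assms] by (intro card)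
    show "card (a1 \<union> a2 - a1 \<inter> a2) = 4" if "card (a1 \<inter> a2) = 0" "card (b1 \<inter> b2) = 0"
      using that pole_boundary_not_disjoint[OF assms] fin by simp
  qed
qed

lemma pole_boundary_card_bounds:
  assumes "pole_boundary a1 a2 b1 b2"
  shows "card a1 + card a2 \<in> {2..4}" "card b1 + card b2 \<in> {2..4}"
proof -
  have "card a \<in> {1..2}" if "tripartition a e f" for a e f
    using tripartition_card[OF that] by simp
  then have "card a1 \<in> {1..2} \<and> card a2 \<in> {1..2} \<and> card b1 \<in> {1..2} \<and> card b2 \<in> {1..2}"
    using assms unfolding pole_boundary_def by blast
  then show "card a1 + card a2 \<in> {2..4}" "card b1 + card b2 \<in> {2..4}"
    by simp_all
qed

lemma pole_boundary_card_3:
  assumes pole: "pole_boundary a1 a2 b1 b2"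
  shows "card a1 + card a2 = 3 \<longleftrightarrow> card b1 + card b2 = 3"
    and "card a1 + card a2 = 3 \<Longrightarrow> card (a1 \<inter> a2) = 1"
    and "card b1 + card b2 = 3 \<Longrightarrow> card (b1 \<inter> b2) = 1"
proof -
  \<comment> \<open>Parity and the bounds give \<open>b = 3\<close>, hence \<open>x = y\<close>. The
    value 0 would force \<open>d = 4 > 3\<close>, so \<open>x = 1\<close>.\<close>
  have *: "b = 3 \<and> x = 1"
    if "a = d + 2 * x" "b = d + 2 * y" "x = 0 \<Longrightarrow> y = 0 \<Longrightarrow> d = 4" "a = 3" "b \<in> {2..4}" for a b d x y :: nat
    using that unfolding atLeastAtMost_iff by presburger
  obtain d where d: "card a1 + card a2 = d + 2 * card (a1 \<inter> a2)" "card b1 + card b2 = d + 2 * card (b1 \<inter> b2)"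
    "card (a1 \<inter> a2) = 0 \<Longrightarrow> card (b1 \<inter> b2) = 0 \<Longrightarrow> d = 4"
    using pole_boundary_card[OF pole] by blast
  note bounds = pole_boundary_card_bounds[OF pole]
  show "card a1 + card a2 = 3 \<longleftrightarrow> card b1 + card b2 = 3"
    and "card a1 + card a2 = 3 \<Longrightarrow> card (a1 \<inter> a2) = 1"
    and "card b1 + card b2 = 3 \<Longrightarrow> card (b1 \<inter> b2) = 1"
    using *[OF d(1,2) d(3) _ bounds(2)] *[OF d(2,1) d(3) _ bounds(1)] by blast+
qed

lemma pole_boundary_card_2:
  assumes pole: "pole_boundary a1 a2 b1 b2"
  shows "card a1 + card a2 = 2 \<Longrightarrow> card (a1 \<inter> a2) = 0 \<Longrightarrow> card b1 + card b2 = 4"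
    and "card b1 + card b2 = 2 \<Longrightarrow> card (b1 \<inter> b2) = 0 \<Longrightarrow> card a1 + card a2 = 4"
proof -
  \<comment> \<open>Here \<open>d = 2\<close>, so \<open>y = 0\<close> is excluded, and the upper
    bound 4 leaves \<open>y = 1\<close>.\<close>
  have *: "b = 4"
    if "a = d + 2 * x" "b = d + 2 * y" "x = 0 \<Longrightarrow> y = 0 \<Longrightarrow> d = 4" "a = 2" "x = 0" "b \<in> {2..4}"
    for a b d x y :: nat
    using that unfolding atLeastAtMost_iff by presburger
  obtain d where d: "card a1 + card a2 = d + 2 * card (a1 \<inter> a2)" "card b1 + card b2 = d + 2 * card (b1 \<inter> b2)"
    "card (a1 \<inter> a2) = 0 \<Longrightarrow> card (b1 \<inter> b2) = 0 \<Longrightarrow> d = 4"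
    using pole_boundary_card[OF pole] by blast
  note bounds = pole_boundary_card_bounds[OF pole]
  show "card a1 + card a2 = 2 \<Longrightarrow> card (a1 \<inter> a2) = 0 \<Longrightarrow> card b1 + card b2 = 4"
    and "card b1 + card b2 = 2 \<Longrightarrow> card (b1 \<inter> b2) = 0 \<Longrightarrow> card a1 + card a2 = 4"
    using *[OF d(1,2) d(3) _ _ bounds(2)] *[OF d(2,1) d(3) _ _ bounds(1)] by blast+
qed

section \<open>Label sizes where two 4-poles meet, and around the ring\<close>

text \<open>The labels at \<open>v\<^sub>i\<close>, \<open>u\<^sub>i\<close>, \<open>w\<^sub>i\<close>: \<open>p\<close> belongs to the edge leaving the cycle, \<open>a1\<close> and \<open>a2\<close> to the
  semiedges of \<open>B\<^bsub>i-1\<^esub>\<close>, and \<open>b1\<close> and \<open>b2\<close> to those of \<open>B\<^sub>i\<close>.\<close>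

definition junction :: "nat set \<Rightarrow> nat set \<Rightarrow> nat set \<Rightarrow> nat set \<Rightarrow> nat set \<Rightarrow> bool" where
  "junction p a1 a2 b1 b2 \<longleftrightarrow>
     (\<exists>q r. tripartition p q r \<and> tripartition q b1 a1 \<and> tripartition r b2 a2)"

text \<open>The labels \<open>q\<close> and \<open>r\<close> must be singletons, which leaves three
  elements for each of the pairs \<open>a1, b1\<close> and \<open>a2, b2\<close>.\<close>

lemma junction_card_2:
  assumes "junction p a1 a2 b1 b2" "card p = 2"
  shows "card a1 + card a2 + card b1 + card b2 = 6"
proof -
  obtain q r where e: "tripartition p q r" "tripartition q b1 a1" "tripartition r b2 a2"
    using assms(1) unfolding junction_def by blast
  show ?thesis
    using e[THEN tripartition_card(1)] e[THEN tripartition_card(3)] e[THEN tripartition_card(4)] assms(2)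
    by linarith
qed

text \<open>An element of \<open>b1 \<inter> b2\<close> or of \<open>a1 \<inter> a2\<close> is in
  neither \<open>q\<close> nor \<open>r\<close>, so it is the single element of \<open>p\<close>. It
  cannot lie in both \<open>b1\<close> and \<open>a1\<close>.\<close>

lemma junction_disjoint:
  assumes e: "tripartition p q r" "tripartition q b1 a1" "tripartition r b2 a2"
    and p: "card p = 1" and b: "b1 \<inter> b2 \<noteq> {}"
  shows "a1 \<inter> a2 = {}"
proof -
  have sub: "b1 \<subseteq> {..<4}" "a1 \<subseteq> {..<4}"
    using e(2) tripartition_subset tripartition_commute by blast+
  have mem: "(x \<in> b1 \<inter> b2 \<longrightarrow> x \<in> p) \<and> (x \<in> a1 \<inter> a2 \<longrightarrow> x \<in> p \<and> x \<notin> b1)" if "x < 4" for x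
    using e[THEN tripartition_exactly_one, OF that] unfolding exactly_one_def Int_iff by argo
  obtain c where "p = {c}"
    using p by (auto simp: card_1_singleton_iff)
  then have "b1 \<inter> b2 \<subseteq> {c}" "a1 \<inter> a2 \<subseteq> {c} - b1"
    using mem sub by auto
  then show ?thesis
    using b by blast
qed

text \<open>One of \<open>q\<close>, \<open>r\<close> has size 1 and the other size 2, so the four
  labels have total size 5 and one side has sum 3. That side intersects by \<open>A\<close> or
  \<open>B\<close>, which \<open>pole_boundary_card_3\<close> supplies for the adjacent 4-poles; the
  other side is then disjoint.\<close>

lemma junction_card_1:
  assumes junction: "junction p a1 a2 b1 b2" and p: "card p = 1"
    and A: "card a1 + card a2 = 3 \<Longrightarrow> card (a1 \<inter> a2) = 1"
    and B: "card b1 + card b2 = 3 \<Longrightarrow> card (b1 \<inter> b2) = 1"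
  shows "card b1 + card b2 = 3 \<and> card a1 + card a2 = 2 \<and> card (a1 \<inter> a2) = 0 \<or>
         card a1 + card a2 = 3 \<and> card b1 + card b2 = 2 \<and> card (b1 \<inter> b2) = 0"
proof -
  obtain q r where e: "tripartition p q r" "tripartition q b1 a1" "tripartition r b2 a2"
    using junction unfolding junction_def by blast
  have e': "tripartition q a1 b1" "tripartition r a2 b2"
    using e by (simp_all add: tripartition_commute)
  have "card a1 + card a2 = 3 \<and> card b1 + card b2 = 2 \<or> card a1 + card a2 = 2 \<and> card b1 + card b2 = 3"
    using e[THEN tripartition_card(1)] e[THEN tripartition_card(2)] e[THEN tripartition_card(3)]
      e[THEN tripartition_card(4)] p by linarith
  moreover have "card (b1 \<inter> b2) = 0" if "card a1 + card a2 = 3"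
    using junction_disjoint[OF e(1) e' p] A[OF that] by force
  moreover have "card (a1 \<inter> a2) = 0" if "card b1 + card b2 = 3"
    using junction_disjoint[OF e p] B[OF that] by force
  ultimately show ?thesis
    by blast
qed

lemma no_ring_1_1_2:
  assumes p: "card p1 = 1" "card p2 = 1" "card p3 = 2"
    and j1: "junction p1 a31 a32 b11 b12" and pole1: "pole_boundary a11 a12 b11 b12"
    and j2: "junction p2 a11 a12 b21 b22" and pole2: "pole_boundary a21 a22 b21 b22"
    and j3: "junction p3 a21 a22 b31 b32" and pole3: "pole_boundary a31 a32 b31 b32"
  shows False
proof -
  \<comment> \<open>The first 4-pole lies between the two junctions with singleton \<open>p\<close>.
    Its ends must both have sum 3: an end of two distinct singletons would face an end of sum 4,
    which such a junction does not admit.\<close>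
  have "\<not> (card a11 + card a12 = 3 \<and> card b11 + card b12 = 2)"
    using pole_boundary_card_3(1)[OF pole1] by simp
  moreover have "\<not> (card b11 + card b12 = 2 \<and> card (b11 \<inter> b12) = 0 \<and>
      (card a11 + card a12 = 2 \<or> card a11 + card a12 = 3))"
    using pole_boundary_card_2(2)[OF pole1] by linarith
  ultimately have "card a31 + card a32 = 2 \<and> card (a31 \<inter> a32) = 0 \<and> card b21 + card b22 = 2 \<and> card (b21 \<inter> b22) = 0"
    using junction_card_1[OF j1 p(1) pole_boundary_card_3(2)[OF pole3] pole_boundary_card_3(3)[OF pole1]]
      junction_card_1[OF j2 p(2) pole_boundary_card_3(2)[OF pole1] pole_boundary_card_3(3)[OF pole2]]
      pole_boundary_card_3(1)[OF pole1] by linarith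
  then have "card b31 + card b32 = 4 \<and> card a21 + card a22 = 4"
    using pole_boundary_card_2(1)[OF pole3] pole_boundary_card_2(2)[OF pole2] by blast
  then show False
    using junction_card_2[OF j3 p(3)] by linarith
qed

lemma no_ring:
  assumes p: "tripartition p1 p2 p3"
    and j: "junction p1 A13 A23 B11 B21" "junction p2 A11 A21 B12 B22" "junction p3 A12 A22 B13 B23"
    and b: "pole_boundary A11 A21 B11 B21" "pole_boundary A12 A22 B12 B22" "pole_boundary A13 A23 B13 B23"
  shows False
proof -
  \<comment> \<open>The cases are cyclic shifts of one another, so the ring can be rotated to put
    the label of size 2 last.\<close>
  have "card p1 = 1 \<and> card p2 = 1 \<and> card p3 = 2 \<or> card p2 = 1 \<and> card p3 = 1 \<and> card p1 = 2 \<or>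
        card p3 = 1 \<and> card p1 = 1 \<and> card p2 = 2"
    using tripartition_card[OF p] by linarith
  then show False
    using no_ring_1_1_2 j b by metis
qed

section \<open>The blowup of the complete graph\<close>

lemma filter_insert:
  "{e \<in> insert x A. P e} = (if P x then {x} else {}) \<union> {e \<in> A. P e}"
  by auto

lemma verts_petersen:
  "verts petersen = {{0, 1}, {0, 2}, {0, 3}, {0, 4}, {1, 2}, {1, 3}, {1, 4}, {2, 3}, {2, 4}, {3, 4}}"
proof -
  have "{0..<5} = {0, 1, 2, 3, 4::nat}"
    by auto
  then have "verts petersen = {s \<in> Pow {0, 1, 2, 3, 4}. card s = 2}"
    by (simp add: petersen_def)
  then show ?thesis
    by (simp only: Pow_insert Pow_empty image_insert image_empty Un_insert_left Un_empty_left filter_insert)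
      (simp add: insert_commute)
qed

lemma edges_petersen:
  "edges petersen = {{s, t} | s t. s \<in> verts petersen \<and> t \<in> verts petersen \<and> s \<inter> t = {}}"
  by (simp add: petersen_def)

lemma verts_pole_B:
  "verts pole_B = {{0, 2}, {0, 3}, {0, 4}, {1, 2}, {1, 3}, {1, 4}, {2, 4}, {3, 4}}"
  by (simp add: pole_B_def verts_petersen pole_x_def pole_y_def insert_Diff_if doubleton_eq_iff)

lemma edges_pole_B:
  "edges pole_B =
     {{{2, 4}, {0, 3}}, {{2, 4}, {1, 3}}, {{3, 4}, {0, 2}}, {{3, 4}, {1, 2}}, {{0, 4}, {1, 2}},
      {{0, 4}, {1, 3}}, {{1, 4}, {0, 2}}, {{1, 4}, {0, 3}}, {{0, 2}, {1, 3}}, {{0, 3}, {1, 2}}}"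
    (is "_ = ?E")
proof
  have E: "\<forall>s\<in>verts pole_B. \<forall>t\<in>verts pole_B. s \<inter> t = {} \<longrightarrow> {s, t} \<in> ?E"
    unfolding verts_pole_B by (simp add: doubleton_eq_iff)
  show "edges pole_B \<subseteq> ?E"
  proof
    fix e assume "e \<in> edges pole_B"
    then obtain s t where st: "e = {s, t}" "s \<in> verts pole_B" "t \<in> verts pole_B" "s \<inter> t = {}"
      unfolding pole_B_def edges_petersen by auto
    show "e \<in> ?E"
      unfolding st(1) by (rule E[rule_format, OF st(2-4)])
  qed
  have "\<forall>e\<in>?E. e \<in> edges petersen"
    by (simp add: petersen_adj_iff)
  then show "?E \<subseteq> edges pole_B"
    by (simp add: pole_B_def pole_x_def pole_y_def doubleton_eq_iff)
qed

lemma blowup_gadget_eq: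
  "blowup_gadget v v' =
     {{Orig v, U v}, {Orig v, W v}, {U v, Pole v {0, 4}}, {W v, Pole v {1, 4}},
      {Pole v {2, 4}, U v'}, {Pole v {3, 4}, W v'},
      {Pole v {2, 4}, Pole v {0, 3}}, {Pole v {2, 4}, Pole v {1, 3}}, {Pole v {3, 4}, Pole v {0, 2}},
      {Pole v {3, 4}, Pole v {1, 2}}, {Pole v {0, 4}, Pole v {1, 2}}, {Pole v {0, 4}, Pole v {1, 3}},
      {Pole v {1, 4}, Pole v {0, 2}}, {Pole v {1, 4}, Pole v {0, 3}}, {Pole v {0, 2}, Pole v {1, 3}},
      {Pole v {0, 3}, Pole v {1, 2}}}"
  unfolding blowup_gadget_def edges_pole_B by (simp add: pole_B_def)

section \<open>The blowup of a triangle in explicit form\<close>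

definition triangle_blowup :: "'a \<Rightarrow> 'a \<Rightarrow> 'a \<Rightarrow> 'a \<Rightarrow> 'a blowup_vertex ugraph" where
  "triangle_blowup z a b c =
     \<lparr>verts = Orig ` {z, a, b, c} \<union> (\<Union>v\<in>{a, b, c}. {U v, W v} \<union> Pole v ` verts pole_B),
      edges = {{Orig z, Orig a}, {Orig z, Orig b}, {Orig z, Orig c}} \<union>
        blowup_gadget a b \<union> blowup_gadget b c \<union> blowup_gadget c a\<rparr>"

text \<open>By this symmetry, incidences and constraints are computed only around \<open>z\<close>
  and \<open>a\<close>.\<close>

lemma triangle_blowup_rotate: "triangle_blowup z a b c = triangle_blowup z b c a"
  unfolding triangle_blowup_def by (simp add: insert_commute Un_ac)

lemma complete_graph_minus_triangle:
  assumes "distinct [z, a, b, c]"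
  shows "edges (complete_graph {z, a, b, c}) - {{a, b}, {b, c}, {c, a}} = {{z, a}, {z, b}, {z, c}}"
proof -
  \<comment> \<open>The reversed list supplies every inequality in the opposite orientation for the
    simplifier.\<close>
  note ne = assms assms[unfolded distinct_rev[of "[z, a, b, c]", symmetric]]
  have "edges (complete_graph {z, a, b, c}) = {e \<in> Pow {z, a, b, c}. card e = 2}"
    by (simp add: complete_graph_def)
  also have "\<dots> = {{z, a}, {z, b}, {z, c}, {a, b}, {b, c}, {c, a}}"
    using ne
    by (simp only: Pow_insert Pow_empty image_insert image_empty Un_insert_left Un_empty_left filter_insert)
      (simp add: card_insert_if insert_commute)
  finally show ?thesis
    using ne by (simp add: insert_Diff_if doubleton_eq_iff)
qed

lemma blowup_complete_graph_triangle:
  assumes "distinct [z, a, b, c]"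
  shows "blowup (complete_graph {z, a, b, c}) {[a, b, c]} = triangle_blowup z a b c"
proof -
  have lt: "{..<3} = {0, 1, 2::nat}"
    by auto
  have "cycle_edges [a, b, c] = (\<lambda>i. {[a, b, c] ! i, [a, b, c] ! next_index [a, b, c] i}) ` {..<3}"
    by (auto simp: cycle_edges_def)
  then have "cycle_edges [a, b, c] = {{a, b}, {b, c}, {c, a}}"
    unfolding lt by (simp add: next_index_def)
  then show ?thesis
    using complete_graph_minus_triangle[OF assms]
    by (simp add: blowup_def triangle_blowup_def lessThan_Suc next_index_def Un_ac, simp add: complete_graph_def)
qed

text \<open>The edges in each triple are listed in the order in which \<open>junction\<close> and
  \<open>pole_boundary\<close> take their labels.\<close>

lemma triangle_blowup_incidence:
  assumes "distinct [z, a, b, c]"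
  defines "I x \<equiv> {e \<in> edges (triangle_blowup z a b c). x \<in> e}"
  shows "I (Orig z) = {{Orig z, Orig a}, {Orig z, Orig b}, {Orig z, Orig c}}"
    and "I (Orig a) = {{Orig z, Orig a}, {Orig a, U a}, {Orig a, W a}}"
    and "I (U a) = {{Orig a, U a}, {U a, Pole a {0, 4}}, {Pole c {2, 4}, U a}}"
    and "I (W a) = {{Orig a, W a}, {W a, Pole a {1, 4}}, {Pole c {3, 4}, W a}}"
    and "I (Pole a {2, 4}) = {{Pole a {2, 4}, U b}, {Pole a {2, 4}, Pole a {0, 3}}, {Pole a {2, 4}, Pole a {1, 3}}}"
    and "I (Pole a {3, 4}) = {{Pole a {3, 4}, W b}, {Pole a {3, 4}, Pole a {1, 2}}, {Pole a {3, 4}, Pole a {0, 2}}}"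
    and "I (Pole a {0, 4}) = {{U a, Pole a {0, 4}}, {Pole a {0, 4}, Pole a {1, 3}}, {Pole a {0, 4}, Pole a {1, 2}}}"
    and "I (Pole a {1, 4}) = {{W a, Pole a {1, 4}}, {Pole a {1, 4}, Pole a {0, 2}}, {Pole a {1, 4}, Pole a {0, 3}}}"
    and "I (Pole a {0, 2}) = {{Pole a {0, 2}, Pole a {1, 3}}, {Pole a {1, 4}, Pole a {0, 2}}, {Pole a {3, 4}, Pole a {0, 2}}}"
    and "I (Pole a {0, 3}) = {{Pole a {0, 3}, Pole a {1, 2}}, {Pole a {1, 4}, Pole a {0, 3}}, {Pole a {2, 4}, Pole a {0, 3}}}"
    and "I (Pole a {1, 2}) = {{Pole a {0, 3}, Pole a {1, 2}}, {Pole a {0, 4}, Pole a {1, 2}}, {Pole a {3, 4}, Pole a {1, 2}}}"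
    and "I (Pole a {1, 3}) = {{Pole a {0, 2}, Pole a {1, 3}}, {Pole a {0, 4}, Pole a {1, 3}}, {Pole a {2, 4}, Pole a {1, 3}}}"
  using assms(1) assms(1)[unfolded distinct_rev[of "[z, a, b, c]", symmetric]] unfolding I_def triangle_blowup_def blowup_gadget_eq ugraph.simps Un_insert_left Un_empty_left filter_insert
  by (simp_all add: doubleton_eq_iff insert_commute)

section \<open>From four perfect matchings to labels\<close>

definition edge_label :: "(nat \<Rightarrow> 'v set set) \<Rightarrow> 'v set \<Rightarrow> nat set" where
  "edge_label M e = {k. k < 4 \<and> e \<in> M k}"

text \<open>Each matching uses exactly one of the three edges at \<open>x\<close>, which makes the
  labels disjoint with union \<open>{..<4}\<close>; the cover makes them nonempty.\<close>

lemma perfect_matchings_tripartition: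
  assumes pm: "\<And>k. k < 4 \<Longrightarrow> perfect_matching G (M k)" and cover: "edges G \<subseteq> (\<Union>k<4. M k)"
    and x: "x \<in> verts G" and inc: "{e \<in> edges G. x \<in> e} = {e, f, g}" and dist: "distinct [e, f, g]"
  shows "tripartition (edge_label M e) (edge_label M f) (edge_label M g)"
proof -
  have inc': "e \<in> edges G" "f \<in> edges G" "g \<in> edges G" "x \<in> e" "x \<in> f" "x \<in> g"
    using inc by blast+
  have "exactly_one (e \<in> M k) (f \<in> M k) (g \<in> M k)" if "k < 4" for k
  proof -
    have sub: "M k \<subseteq> edges G" and "\<exists>!h. h \<in> M k \<and> x \<in> h"
      using pm[OF that] x unfolding perfect_matching_def by blast+
    then obtain h where h: "h \<in> M k" "x \<in> h" "\<And>h'. h' \<in> M k \<Longrightarrow> x \<in> h' \<Longrightarrow> h' = h"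
      by blast
    have "h \<in> {e, f, g}"
      using h sub inc by blast
    moreover have "e \<in> M k \<longrightarrow> h = e" "f \<in> M k \<longrightarrow> h = f" "g \<in> M k \<longrightarrow> h = g"
      using h(3) inc' by blast+
    ultimately show ?thesis
      using h(1) dist unfolding exactly_one_def by (elim insertE) auto
  qed
  then have one: "\<forall>k<4. exactly_one (e \<in> M k) (f \<in> M k) (g \<in> M k)"
    by blast
  have ne: "\<exists>k<4. h \<in> M k" if "h \<in> edges G" for h
    using cover that by blast
  show ?thesis
    using one ne[OF inc'(1)] ne[OF inc'(2)] ne[OF inc'(3)]
    unfolding tripartition_def edge_label_def exactly_one_def
    by (simp add: set_eq_iff) blast
qed

lemma triangle_blowup_local:
  assumes dist: "distinct [z, a, b, c]"
    and pm: "\<And>k. k < 4 \<Longrightarrow> perfect_matching (triangle_blowup z a b c) (M k)"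
    and cover: "edges (triangle_blowup z a b c) \<subseteq> (\<Union>k<4. M k)"
  defines "L \<equiv> edge_label M"
  shows "tripartition (L {Orig z, Orig a}) (L {Orig z, Orig b}) (L {Orig z, Orig c})"
    and "junction (L {Orig z, Orig a}) (L {Pole c {2, 4}, U a}) (L {Pole c {3, 4}, W a})
           (L {U a, Pole a {0, 4}}) (L {W a, Pole a {1, 4}})"
    and "pole_boundary (L {Pole a {2, 4}, U b}) (L {Pole a {3, 4}, W b})
           (L {U a, Pole a {0, 4}}) (L {W a, Pole a {1, 4}})"
proof -
  have verts: "x \<in> verts (triangle_blowup z a b c)"
    if "x \<in> {Orig z, Orig a, U a, W a} \<union> Pole a ` verts pole_B" for x
    using that by (auto simp: triangle_blowup_def)
  note part = perfect_matchings_tripartition[OF pm cover verts, folded L_def]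
  note inc = triangle_blowup_incidence[OF dist]
  show "tripartition (L {Orig z, Orig a}) (L {Orig z, Orig b}) (L {Orig z, Orig c})"
    using dist by (intro part[OF _ _ inc(1)]) (simp_all add: doubleton_eq_iff)
  have "tripartition (L {Orig z, Orig a}) (L {Orig a, U a}) (L {Orig a, W a})"
    using dist by (intro part[OF _ _ inc(2)]) (simp_all add: doubleton_eq_iff)
  moreover have "tripartition (L {Orig a, U a}) (L {U a, Pole a {0, 4}}) (L {Pole c {2, 4}, U a})"
    using dist by (intro part[OF _ _ inc(3)]) (simp_all add: doubleton_eq_iff)
  moreover have "tripartition (L {Orig a, W a}) (L {W a, Pole a {1, 4}}) (L {Pole c {3, 4}, W a})"
    using dist by (intro part[OF _ _ inc(4)]) (simp_all add: doubleton_eq_iff)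
  ultimately show "junction (L {Orig z, Orig a}) (L {Pole c {2, 4}, U a}) (L {Pole c {3, 4}, W a})
           (L {U a, Pole a {0, 4}}) (L {W a, Pole a {1, 4}})"
    unfolding junction_def by blast
  show "pole_boundary (L {Pole a {2, 4}, U b}) (L {Pole a {3, 4}, W b})
           (L {U a, Pole a {0, 4}}) (L {W a, Pole a {1, 4}})"
    unfolding pole_boundary_def
    \<comment> \<open>The inner labels are still schematic and are fixed by unification with the
      incidence triples.\<close>
    by (intro exI conjI; rule part[OF _ _ inc(5)] part[OF _ _ inc(6)] part[OF _ _ inc(7)] part[OF _ _ inc(8)]
        part[OF _ _ inc(9)] part[OF _ _ inc(10)] part[OF _ _ inc(11)] part[OF _ _ inc(12)])
      (simp_all add: doubleton_eq_iff verts_pole_B)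
qed

lemma triangle_blowup_not_covered:
  fixes M :: "nat \<Rightarrow> 'a blowup_vertex set set"
  assumes dist: "distinct [z, a, b, c]"
    and pm: "\<And>k. k < 4 \<Longrightarrow> perfect_matching (triangle_blowup z a b c) (M k)"
  shows "\<not> edges (triangle_blowup z a b c) \<subseteq> (\<Union>k<4. M k)"
proof
  assume cover: "edges (triangle_blowup z a b c) \<subseteq> (\<Union>k<4. M k)"
  have dist': "distinct [z, b, c, a]" "distinct [z, c, a, b]"
    using dist by auto
  note rotate = triangle_blowup_rotate[of z a b c] triangle_blowup_rotate[of z b c a]
  note local_a = triangle_blowup_local[OF dist pm cover]
  note local_b = triangle_blowup_local[OF dist'(1), folded rotate, OF pm cover]
  note local_c = triangle_blowup_local[OF dist'(2), folded rotate, OF pm cover]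
  show False
    by (rule no_ring[OF local_a(1) local_a(2) local_b(2) local_c(2) local_a(3) local_b(3) local_c(3)])
qed

text \<open>This turns the matching property into checks by evaluation. First and second components
  never coincide, so two pairs sharing a vertex agree in a component and, by distinctness, are
  equal.\<close>

lemma perfect_matching_of_pairs:
  assumes dist: "distinct (map fst ps @ map snd ps)" and verts: "set (map fst ps @ map snd ps) = verts G"
    and edges: "\<forall>(x, y)\<in>set ps. {x, y} \<in> edges G"
  shows "perfect_matching G ((\<lambda>(x, y). {x, y}) ` set ps)"
  unfolding perfect_matching_def
proof (intro conjI ballI)
  show "(\<lambda>(x, y). {x, y}) ` set ps \<subseteq> edges G"
    using edges by auto
  have unique: "{x, y} = {x', y'}"
    if "(x, y) \<in> set ps" "(x', y') \<in> set ps" "{x, y} \<inter> {x', y'} \<noteq> {}" for x y x' y'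
  proof -
    have inj: "inj_on fst (set ps)" "inj_on snd (set ps)" "fst ` set ps \<inter> snd ` set ps = {}"
      using dist by (simp_all add: distinct_map)
    have "p \<in> fst ` set ps \<and> q \<in> snd ` set ps" if "(p, q) \<in> set ps" for p q
      using that by force
    then have "x = x' \<or> y = y'"
      using that inj(3) by blast
    then show ?thesis
      using inj_onD[OF inj(1), of "(x, y)" "(x', y')"] inj_onD[OF inj(2), of "(x, y)" "(x', y')"] that
      by auto
  qed
  fix v assume "v \<in> verts G"
  then have "v \<in> fst ` set ps \<union> snd ` set ps"
    using verts by simp
  then obtain x y where xy: "(x, y) \<in> set ps" "v \<in> {x, y}"
    by force
  have "e = {x, y}" if e: "e \<in> (\<lambda>(x, y). {x, y}) ` set ps" "v \<in> e" for e
  proof -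
    obtain x' y' where "(x', y') \<in> set ps" "e = {x', y'}"
      using e(1) by auto
    then show ?thesis
      using unique[OF _ xy(1)] xy(2) e(2) by blast
  qed
  then show "\<exists>!e. e \<in> (\<lambda>(x, y). {x, y}) ` set ps \<and> v \<in> e"
    using xy by (intro ex1I[of _ "{x, y}"]) auto
qed

section \<open>A cover by five perfect matchings\<close>

text \<open>Three rotations of the first matching and two of the second one cover all edges.\<close>

definition five_cover_pairs1 :: "'a \<Rightarrow> 'a \<Rightarrow> 'a \<Rightarrow> 'a \<Rightarrow> ('a blowup_vertex \<times> 'a blowup_vertex) list" where
  "five_cover_pairs1 z a b c =
     [(Orig z, Orig b), (Pole a {0, 2}, Pole a {1, 3}), (Pole a {0, 3}, Pole a {1, 4}),
      (Pole a {0, 4}, Pole a {1, 2}), (Orig a, U a), (Pole a {2, 4}, U b), (Pole a {3, 4}, W b),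
      (Pole b {0, 2}, Pole b {1, 4}), (Pole b {0, 3}, Pole b {2, 4}),
      (Pole b {0, 4}, Pole b {1, 3}), (Pole b {1, 2}, Pole b {3, 4}),
      (Pole c {0, 2}, Pole c {1, 4}), (Pole c {0, 3}, Pole c {1, 2}),
      (Pole c {1, 3}, Pole c {2, 4}), (Orig c, W c), (U c, Pole c {0, 4}), (Pole c {3, 4}, W a)]"

definition five_cover_pairs2 :: "'a \<Rightarrow> 'a \<Rightarrow> 'a \<Rightarrow> 'a \<Rightarrow> ('a blowup_vertex \<times> 'a blowup_vertex) list" where
  "five_cover_pairs2 z a b c =
     [(Orig z, Orig a), (Pole a {0, 2}, Pole a {1, 3}), (Pole a {0, 3}, Pole a {2, 4}),
      (Pole a {0, 4}, Pole a {1, 2}), (W a, Pole a {1, 4}), (Pole a {3, 4}, W b),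
      (Pole b {0, 2}, Pole b {3, 4}), (Pole b {0, 3}, Pole b {1, 4}),
      (Pole b {0, 4}, Pole b {1, 2}), (Pole b {1, 3}, Pole b {2, 4}), (Orig b, U b),
      (Pole c {0, 2}, Pole c {3, 4}), (Pole c {0, 3}, Pole c {1, 2}),
      (Pole c {0, 4}, Pole c {1, 3}), (Orig c, U c), (W c, Pole c {1, 4}), (Pole c {2, 4}, U a)]"

lemma perfect_matching_five_cover:
  assumes "distinct [z, a, b, c]"
  shows "perfect_matching (triangle_blowup z a b c) ((\<lambda>(x, y). {x, y}) ` set (five_cover_pairs1 z a b c))"
    and "perfect_matching (triangle_blowup z a b c) ((\<lambda>(x, y). {x, y}) ` set (five_cover_pairs2 z a b c))"
proof -
  note ne = assms assms[unfolded distinct_rev[of "[z, a, b, c]", symmetric]]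
  show "perfect_matching (triangle_blowup z a b c) ((\<lambda>(x, y). {x, y}) ` set (five_cover_pairs1 z a b c))"
  proof (rule perfect_matching_of_pairs)
    show "distinct (map fst (five_cover_pairs1 z a b c) @ map snd (five_cover_pairs1 z a b c))"
      using ne by (simp add: five_cover_pairs1_def doubleton_eq_iff)
    show "set (map fst (five_cover_pairs1 z a b c) @ map snd (five_cover_pairs1 z a b c)) =
        verts (triangle_blowup z a b c)"
      by (simp add: five_cover_pairs1_def triangle_blowup_def verts_pole_B insert_commute)
    show "\<forall>(x, y)\<in>set (five_cover_pairs1 z a b c). {x, y} \<in> edges (triangle_blowup z a b c)"
      by (simp add: five_cover_pairs1_def triangle_blowup_def blowup_gadget_eq insert_commute)
  qed
  show "perfect_matching (triangle_blowup z a b c) ((\<lambda>(x, y). {x, y}) ` set (five_cover_pairs2 z a b c))"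
  proof (rule perfect_matching_of_pairs)
    show "distinct (map fst (five_cover_pairs2 z a b c) @ map snd (five_cover_pairs2 z a b c))"
      using ne by (simp add: five_cover_pairs2_def doubleton_eq_iff)
    show "set (map fst (five_cover_pairs2 z a b c) @ map snd (five_cover_pairs2 z a b c)) =
        verts (triangle_blowup z a b c)"
      by (simp add: five_cover_pairs2_def triangle_blowup_def verts_pole_B insert_commute)
    show "\<forall>(x, y)\<in>set (five_cover_pairs2 z a b c). {x, y} \<in> edges (triangle_blowup z a b c)"
      by (simp add: five_cover_pairs2_def triangle_blowup_def blowup_gadget_eq insert_commute)
  qed
qed

lemma triangle_blowup_five_cover:
  assumes dist: "distinct [z, a, b, c]"
  obtains \<M> where "finite \<M>" "card \<M> \<le> 5" "\<forall>M\<in>\<M>. perfect_matching (triangle_blowup z a b c) M"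
    "\<Union>\<M> = edges (triangle_blowup z a b c)"
proof -
  define F where "F ps = (\<lambda>(x, y). {x, y}) ` set ps" for ps :: "('a blowup_vertex \<times> 'a blowup_vertex) list"
  have dist': "distinct [z, b, c, a]" "distinct [z, c, a, b]"
    using dist by auto
  note rotate = triangle_blowup_rotate[of z a b c] triangle_blowup_rotate[of z b c a]
  let ?\<M> = "{F (five_cover_pairs1 z a b c), F (five_cover_pairs1 z b c a), F (five_cover_pairs1 z c a b),
    F (five_cover_pairs2 z a b c), F (five_cover_pairs2 z b c a)}"
  show thesis
  proof (rule that[of ?\<M>])
    show "finite ?\<M>"
      by simp
    show "card ?\<M> \<le> 5"
      by (simp add: card_insert_if)
    show pm: "\<forall>M\<in>?\<M>. perfect_matching (triangle_blowup z a b c) M"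
      using perfect_matching_five_cover[OF dist] perfect_matching_five_cover[OF dist'(1), folded rotate]
        perfect_matching_five_cover[OF dist'(2), folded rotate]
      by (simp add: F_def)
    \<comment> \<open>The cover is checked edge by edge; the converse inclusion holds since
      matchings consist of edges.\<close>
    have "edges (triangle_blowup z a b c) \<subseteq> \<Union>?\<M>"
      unfolding triangle_blowup_def F_def
      by (simp add: five_cover_pairs1_def five_cover_pairs2_def blowup_gadget_eq insert_commute)
    then show "\<Union>?\<M> = edges (triangle_blowup z a b c)"
      using pm by (auto simp: perfect_matching_def simp del: insert_iff)
  qed
qed

section \<open>The value of the index\<close>

lemma finite_family_eq_image:
  assumes "finite \<M>" "card \<M> \<le> n" "\<M> \<noteq> {}"
  obtains M :: "nat \<Rightarrow> 'b" where "\<M> = M ` {..<n}"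
proof -
  obtain h where h: "bij_betw h {0..<card \<M>} \<M>"
    using ex_bij_betw_nat_finite[OF assms(1)] by blast
  have pos: "0 < card \<M>"
    using assms by (simp add: card_gt_0_iff)
  \<comment> \<open>Indices beyond the family repeat its member \<open>h 0\<close>, so a smaller
    family also becomes a sequence of length \<open>n\<close>.\<close>
  define M where "M k = h (if k < card \<M> then k else 0)" for k
  have "M ` {..<n} = h ` {0..<card \<M>}"
  proof
    show "M ` {..<n} \<subseteq> h ` {0..<card \<M>}"
      using pos by (auto simp: M_def)
    show "h ` {0..<card \<M>} \<subseteq> M ` {..<n}"
      using assms(2) by (force simp: M_def)
  qed
  then show thesis
    using h that[of M] by (simp add: bij_betw_def)
qed

lemma perfect_matching_index_triangle_blowup:
  assumes dist: "distinct [z, a, b, c]"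
  shows "perfect_matching_index (triangle_blowup z a b c) = 5"
proof (rule antisym)
  obtain \<M> where \<M>: "finite \<M>" "card \<M> \<le> 5" "\<forall>M\<in>\<M>. perfect_matching (triangle_blowup z a b c) M"
    "\<Union>\<M> = edges (triangle_blowup z a b c)"
    using triangle_blowup_five_cover[OF dist] .
  then have "perfect_matching_index (triangle_blowup z a b c) \<le> enat (card \<M>)"
    unfolding perfect_matching_index_def by (intro Inf_lower) blast
  also have "\<dots> \<le> 5"
    using \<M>(2) by (simp add: numeral_eq_enat)
  finally show "perfect_matching_index (triangle_blowup z a b c) \<le> 5" .
next
  have "5 \<le> enat (card \<M>)"
    if \<M>: "finite \<M>" "\<forall>M\<in>\<M>. perfect_matching (triangle_blowup z a b c) M"
      "\<Union>\<M> = edges (triangle_blowup z a b c)" for \<M>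
  proof (rule ccontr)
    assume "\<not> 5 \<le> enat (card \<M>)"
    then have "card \<M> \<le> 4"
      by (simp add: numeral_eq_enat)
    \<comment> \<open>The graph has an edge to cover; padding the family to four matchings requires
      a member to repeat.\<close>
    moreover have "\<M> \<noteq> {}"
      using \<M>(3) by (auto simp: triangle_blowup_def)
    ultimately obtain M :: "nat \<Rightarrow> 'a blowup_vertex set set" where M: "\<M> = M ` {..<4}"
      using finite_family_eq_image[of \<M> 4] \<M>(1) by auto
    show False
      using triangle_blowup_not_covered[OF dist, of M] \<M>(2,3) unfolding M by simp
  qed
  then show "5 \<le> perfect_matching_index (triangle_blowup z a b c)"
    unfolding perfect_matching_index_def by (intro Inf_greatest) blast
qed

theorem mainTheorem4:
  fixes V :: "'a set" and C :: "'a list"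
  assumes "card V = 4"
    and "is_cycle (complete_graph V) C"
    and "length C = 3"
  shows "perfect_matching_index (blowup (complete_graph V) {C}) = 5"
proof -
  obtain a b c where C: "C = [a, b, c]"
    using assms(3) by (auto simp: numeral_3_eq_3 length_Suc_conv)
  have "distinct [a, b, c]" "{a, b, c} \<subseteq> V"
    using assms(2) unfolding C is_cycle_def complete_graph_def by simp_all
  moreover from this have "card (V - {a, b, c}) = 1"
    using assms(1) by (simp add: card_Diff_subset)
  then obtain z where "V - {a, b, c} = {z}"
    by (auto simp: card_1_singleton_iff)
  ultimately have "V = {z, a, b, c}" "distinct [z, a, b, c]"
    by auto
  then show ?thesis
    by (simp only: C blowup_complete_graph_triangle perfect_matching_index_triangle_blowup)
qed

end
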